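(* Let $d\in\mathbb{N}$, $\Omega\subset\mathbb{R}^d$, and write $\mathcal{H}_{a,p}:=\mathcal{H}_{a,p}(\Omega)$ for the native space of $k_{a,p}$ on $\Omega$. For any $a\geq 0$, $p\in\mathbb{N}$ we have the following. (i) If $0<a'\leq a$, then the native spaces of $k_{a,p}$ and $k_{a',p}$ are norm equivalent, i.e., $\mathcal{H}_{a,p}=\mathcal{H}_{a',p}$ as sets and $$\left(\frac{a'}{a}\right)^{p/2}\|f\|_{\mathcal{H}_{a',p}}\leq\|f\|_{\mathcal{H}_{a,p}}\leq\|f\|_{\mathcal{H}_{a',p}}\quad\text{for all } f\in\mathcal{H}_{a,p},$$ while for any $a>0$ it holds $\mathcal{H}_{0,p}\subset\mathcal{H}_{a,p}$ with $\|f\|_{\mathcal{H}_{a,p}}=\|f\|_{\mathcal{H}_{0,p}}$ for all $f\in\mathcal{H}_{0,p}$. (ii) If $a>0$ and $p,q\in\mathbb{N}$ with $0\leq q\leq p$, then $\mathcal{H}_{a,q}\subset\mathcal{H}_{a,p}$, and the norms of the two spaces are equivalent on $\mathcal{H}_{a,q}$ with $$a^{(q-p)/2}\,\|f\|_{\mathcal{H}_{a,p}}\leq\|f\|_{\mathcal{H}_{a,q}}\leq a^{(q-p)/2}\binom{p}{p-q}^{1/2}\|f\|_{\mathcal{H}_{a,p}}\quad\text{for all } f\in\mathcal{H}_{a,q}.$$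
   Context: The polynomial kernel with parameters $a\ge 0$, $p\in\mathbb{N}$ is $k_{a,p}(x,y):=(a+\langle x,y\rangle)^p$, $x,y\in\Omega$, with the Euclidean inner product. Its native space (reproducing kernel Hilbert space) $\mathcal{H}_{a,p}(\Omega)$ is the unique Hilbert space of functions $\Omega\to\mathbb{R}$ with $k_{a,p}(\cdot,x)\in\mathcal{H}_{a,p}(\Omega)$ for all $x\in\Omega$ and $\langle k_{a,p}(\cdot,x),f\rangle_{\mathcal{H}_{a,p}}=f(x)$ for all $x\in\Omega$, $f\in\mathcal{H}_{a,p}(\Omega)$. It is described as the space of polynomials over $\Omega$ of total degree at most $p$ (if $a>0$), or homogeneous of degree $p$ (if $a=0$), with inner product $\langle f,g\rangle_{\mathcal{H}_{a,p}}=\sum_{\gamma}\frac{1}{w_\gamma^a}D^\gamma f(0)D^\gamma g(0)$, the sum running over multi-indices $\gamma\in\mathbb{N}_0^d$ with $|\gamma|\le p$ (if $a>0$) or $|\gamma|=p$ (if $a=0$), where $w_\gamma^a=\frac{p!\,\gamma!}{(p-|\gamma|)!}a^{p-|\gamma|}$ for $a>0$ and $w_\gamma^0=p!\,\gamma!$, and $D^\gamma f(0)$ is the partial derivative of multi-index $\gamma$ of the polynomial $f$ at the origin.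
   Formalization: In (ii) the factor a^{(q-p)/2} is corrected to a^{(p-q)/2} in both bounds; the norm equality in (i) and the upper bound in (ii) are stated only for Ω on which polynomials of degree at most p are determined by their values (both fail, e.g., for suitable one-point Ω). *)

theory Defs
  imports "HOL-Analysis.Analysis"
begin

text \<open>A function on \<open>\<Omega>\<close> is represented by its extension by zero to the whole type, so that
  equality of functions on \<open>\<Omega>\<close> is equality in HOL. In the locales below, only the values of \<open>ip\<close> on \<open>V \<times> V\<close> are constrained.\<close>

definition ip_norm :: "(('a \<Rightarrow> real) \<Rightarrow> ('a \<Rightarrow> real) \<Rightarrow> real) \<Rightarrow> ('a \<Rightarrow> real) \<Rightarrow> real" where
  "ip_norm ip f = sqrt (ip f f)"

locale hilbert_function_space =
  fixes \<Omega> :: "'a set"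
    and V :: "('a \<Rightarrow> real) set"
    and ip :: "('a \<Rightarrow> real) \<Rightarrow> ('a \<Rightarrow> real) \<Rightarrow> real"
  assumes supported: "\<And>f x. f \<in> V \<Longrightarrow> x \<notin> \<Omega> \<Longrightarrow> f x = 0"
    and zero_mem: "(\<lambda>_. 0) \<in> V"
    and add_mem: "\<And>f g. f \<in> V \<Longrightarrow> g \<in> V \<Longrightarrow> (\<lambda>x. f x + g x) \<in> V"
    and scale_mem: "\<And>c f. f \<in> V \<Longrightarrow> (\<lambda>x. c * f x) \<in> V"
    and ip_sym: "\<And>f g. f \<in> V \<Longrightarrow> g \<in> V \<Longrightarrow> ip f g = ip g f"
    and ip_add: "\<And>f g h. f \<in> V \<Longrightarrow> g \<in> V \<Longrightarrow> h \<in> V \<Longrightarrow>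
                   ip (\<lambda>x. f x + g x) h = ip f h + ip g h"
    and ip_scale: "\<And>c f g. f \<in> V \<Longrightarrow> g \<in> V \<Longrightarrow> ip (\<lambda>x. c * f x) g = c * ip f g"
    and ip_nonneg: "\<And>f. f \<in> V \<Longrightarrow> 0 \<le> ip f f"
    and ip_definite: "\<And>f. f \<in> V \<Longrightarrow> ip f f = 0 \<Longrightarrow> f = (\<lambda>_. 0)"
    and complete_V: "\<And>F :: nat \<Rightarrow> 'a \<Rightarrow> real.
          (\<And>n. F n \<in> V) \<Longrightarrow>
          (\<forall>e>0. \<exists>N. \<forall>m\<ge>N. \<forall>n\<ge>N. ip_norm ip (\<lambda>x. F m x - F n x) < e) \<Longrightarrow>
          \<exists>f\<in>V. (\<lambda>n. ip_norm ip (\<lambda>x. F n x - f x)) \<longlonglongrightarrow> 0"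

definition kernel_section :: "'a set \<Rightarrow> ('a \<Rightarrow> 'a \<Rightarrow> real) \<Rightarrow> 'a \<Rightarrow> 'a \<Rightarrow> real" where
  "kernel_section \<Omega> k x = (\<lambda>y. if y \<in> \<Omega> then k y x else 0)"

locale native_space = hilbert_function_space \<Omega> V ip
  for \<Omega> :: "'a set" and k :: "'a \<Rightarrow> 'a \<Rightarrow> real" and V ip +
  assumes section_mem: "\<And>x. x \<in> \<Omega> \<Longrightarrow> kernel_section \<Omega> k x \<in> V"
    and reproducing: "\<And>x f. x \<in> \<Omega> \<Longrightarrow> f \<in> V \<Longrightarrow> ip (kernel_section \<Omega> k x) f = f x"

definition poly_kernel :: "real \<Rightarrow> nat \<Rightarrow> real ^ 'n \<Rightarrow> real ^ 'n \<Rightarrow> real" where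
  "poly_kernel a p x y = (a + x \<bullet> y) ^ p"

definition multi_indices :: "nat \<Rightarrow> ('n::finite \<Rightarrow> nat) set" where
  "multi_indices p = {\<gamma>. (\<Sum>i\<in>UNIV. \<gamma> i) \<le> p}"

text \<open>\<open>determines_polys p \<Omega>\<close>: a polynomial of total degree at most \<open>p\<close> is determined by its
  restriction to \<open>\<Omega>\<close>. This is what makes the derivatives at the origin of a polynomial function
  on \<open>\<Omega>\<close> (its coefficients, up to factorials) well defined. It holds for every \<open>p\<close> as soon
  as \<open>\<Omega>\<close> has nonempty interior.\<close>

definition determines_polys :: "nat \<Rightarrow> (real ^ 'n) set \<Rightarrow> bool" where
  "determines_polys p \<Omega> \<longleftrightarrow>
     (\<forall>c :: ('n \<Rightarrow> nat) \<Rightarrow> real.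
        (\<forall>x\<in>\<Omega>. (\<Sum>\<gamma>\<in>multi_indices p. c \<gamma> * (\<Prod>i\<in>UNIV. (x $ i) ^ \<gamma> i)) = 0) \<longrightarrow>
        (\<forall>\<gamma>\<in>multi_indices p. c \<gamma> = 0))"

end

theory Submission
  imports Defs "HOL-Library.Multiset"
begin

text \<open>
  The polynomial kernel has the finite expansion
  \<open>(b + \<langle>x, y\<rangle>)\<^sup>m = (\<Sum>\<gamma>. w \<gamma> * x\<^sup>\<gamma> * y\<^sup>\<gamma>)\<close> with positive weights \<open>w \<gamma>\<close>, where \<open>\<gamma>\<close> runs over all
  multi-indices of degree at most \<open>m\<close> if \<open>b > 0\<close> and over those of degree exactly \<open>m\<close> if \<open>b = 0\<close>
  (\<open>poly_kernel_expansion\<close>, \<open>poly_kernel_zero_expansion\<close>).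

  For a kernel with such an expansion in features \<open>\<phi> \<gamma>\<close>, the native space consists of the functions
  \<open>\<Sum>\<gamma>. c \<gamma> * \<phi> \<gamma>\<close>, and \<open>\<parallel>f\<parallel>\<^sup>2\<close> is the minimum of \<open>\<Sum>\<gamma>. (c \<gamma>)\<^sup>2 / w \<gamma>\<close> over all coefficient vectors
  \<open>c\<close> that represent \<open>f\<close> (\<open>feature_combination_mem\<close>, \<open>norm_attained\<close>, \<open>norm_le_coefficients\<close>). This
  holds on every \<open>\<Omega>\<close>, also when the features are linearly dependent there, which is why a minimum
  appears in place of the explicit formula with derivatives at the origin.

  A comparison of the weights of two kernels therefore compares their norms: taking a minimal
  representation for the first kernel and using it as a competitor for the second gives every
  inclusion and every upper bound on the norm of the larger space (\<open>native_space_mono\<close>). In the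
  opposite direction, a minimal representation for the larger space might use features that the
  smaller space lacks. If the features are linearly independent on \<open>\<Omega>\<close>, which is what
  \<open>determines_polys\<close> says of monomials, the representation is unique and this cannot happen
  (\<open>native_norm_le_of_independent\<close>).

  With \<open>|\<gamma>| = j\<close>, the weight of \<open>x\<^sup>\<gamma>\<close> in degree \<open>m\<close> is \<open>(m choose j) * b ^ (m - j)\<close> times a factor that
  depends only on \<open>\<gamma>\<close>. All the constants of the theorem are bounds for ratios of such numbers.
\<close>

section \<open>Normal equations in spaces of functions\<close>

text \<open>Projection arguments are applied both to native spaces and to spaces of coefficient vectors with
  a weighted Euclidean form. The latter is only semidefinite, as it ignores coordinates outside its
  index set.\<close>

locale semi_inner_product_space =
  fixes V :: "('a \<Rightarrow> real) set"
    and ip :: "('a \<Rightarrow> real) \<Rightarrow> ('a \<Rightarrow> real) \<Rightarrow> real"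
  assumes zero_in: "(\<lambda>_. 0) \<in> V"
    and add_in: "\<And>f g. f \<in> V \<Longrightarrow> g \<in> V \<Longrightarrow> (\<lambda>x. f x + g x) \<in> V"
    and scale_in: "\<And>c f. f \<in> V \<Longrightarrow> (\<lambda>x. c * f x) \<in> V"
    and form_sym: "\<And>f g. f \<in> V \<Longrightarrow> g \<in> V \<Longrightarrow> ip f g = ip g f"
    and form_add: "\<And>f g h. f \<in> V \<Longrightarrow> g \<in> V \<Longrightarrow> h \<in> V \<Longrightarrow>
                   ip (\<lambda>x. f x + g x) h = ip f h + ip g h"
    and form_scale: "\<And>c f g. f \<in> V \<Longrightarrow> g \<in> V \<Longrightarrow> ip (\<lambda>x. c * f x) g = c * ip f g"
    and form_nonneg: "\<And>f. f \<in> V \<Longrightarrow> 0 \<le> ip f f"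
begin

lemma sum_in:
  assumes "\<And>x. x \<in> X \<Longrightarrow> v x \<in> V"
  shows "(\<lambda>y. \<Sum>x\<in>X. \<alpha> x * v x y) \<in> V"
  using assms
proof (induction X rule: infinite_finite_induct)
  case (insert z X)
  then show ?case by (simp add: add_in scale_in)
qed (simp_all add: zero_in)

lemma form_sum_left:
  assumes "\<And>x. x \<in> X \<Longrightarrow> v x \<in> V" and "g \<in> V"
  shows "ip (\<lambda>y. \<Sum>x\<in>X. \<alpha> x * v x y) g = (\<Sum>x\<in>X. \<alpha> x * ip (v x) g)"
proof -
  have zero: "ip (\<lambda>_. 0) g = 0"
    using form_scale[of g g 0] assms(2) by simp
  show ?thesis
    using assms(1)
  proof (induction X rule: infinite_finite_induct)
    case (insert z X)
    then have "ip (\<lambda>y. \<alpha> z * v z y + (\<Sum>x\<in>X. \<alpha> x * v x y)) g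
        = ip (\<lambda>y. \<alpha> z * v z y) g + ip (\<lambda>y. \<Sum>x\<in>X. \<alpha> x * v x y) g"
      using assms(2) by (intro form_add) (simp_all add: scale_in sum_in)
    with insert show ?case using assms(2) by (simp add: form_scale)
  qed (simp_all add: zero)
qed

lemma null_vector_orthogonal:
  assumes u: "u \<in> V" and g: "g \<in> V" and null: "ip u u = 0"
  shows "ip u g = 0"
proof (rule ccontr)
  assume ne: "ip u g \<noteq> 0"
  have expand: "ip (\<lambda>x. g x + t * u x) (\<lambda>x. g x + t * u x) = ip g g + 2 * t * ip u g" for t
  proof -
    have tu: "(\<lambda>x. t * u x) \<in> V" and gtu: "(\<lambda>x. g x + t * u x) \<in> V"
      using u g by (simp_all add: scale_in add_in)
    have "ip (\<lambda>x. g x + t * u x) h = ip g h + t * ip u h" if "h \<in> V" for h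
      using that g u tu by (simp add: form_add form_scale)
    note left = this
    have "ip g (\<lambda>x. g x + t * u x) = ip g g + t * ip u g"
      using left[OF g] form_sym[OF g gtu] by simp
    moreover have "ip u (\<lambda>x. g x + t * u x) = ip u g"
      using left[OF u] form_sym[OF u gtu] form_sym[OF g u] null by simp
    ultimately show ?thesis
      using left[OF gtu] by simp
  qed
  \<comment> \<open>the form is affine along \<open>g + t u\<close>, so a nonzero slope makes it negative somewhere\<close>
  have "ip g g + 2 * (- (ip g g + 1) / (2 * ip u g)) * ip u g = -1"
    using ne by (simp add: field_simps)
  moreover have "0 \<le> ip g g + 2 * t * ip u g" for t
    using form_nonneg[of "\<lambda>x. g x + t * u x"] u g by (simp add: expand scale_in add_in)
  ultimately show False
    by (metis not_one_le_zero neg_0_le_iff_le)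
qed

text \<open>The coefficients \<open>\<alpha>\<close> are those of an orthogonal projection of \<open>f\<close> onto the span of the \<open>v x\<close>. A
  new vector \<open>v z\<close> is accommodated as in the Gram--Schmidt process: only its component \<open>u\<close> orthogonal
  to the earlier vectors matters, and a component of norm zero imposes no condition.\<close>

lemma normal_equations_solvable:
  assumes "finite X" and "\<And>x. x \<in> X \<Longrightarrow> v x \<in> V" and "f \<in> V"
  shows "\<exists>\<alpha>. \<forall>y\<in>X. ip f (v y) = (\<Sum>x\<in>X. \<alpha> x * ip (v x) (v y))"
  using assms
proof (induction X arbitrary: f rule: finite_induct)
  case (insert z X)
  have vz: "v z \<in> V" and vX: "\<And>x. x \<in> X \<Longrightarrow> v x \<in> V"
    using insert.prems by auto
  obtain \<delta> where \<delta>: "\<And>y. y \<in> X \<Longrightarrow> ip (v z) (v y) = (\<Sum>x\<in>X. \<delta> x * ip (v x) (v y))"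
    using insert.IH[OF vX vz] by blast
  obtain \<beta> where \<beta>: "\<And>y. y \<in> X \<Longrightarrow> ip f (v y) = (\<Sum>x\<in>X. \<beta> x * ip (v x) (v y))"
    using insert.IH[OF vX insert.prems(2)] by blast
  define d where "d = (\<lambda>y. \<Sum>x\<in>X. \<delta> x * v x y)"
  define r where "r = (\<lambda>y. f y + (-1) * (\<Sum>x\<in>X. \<beta> x * v x y))"
  define u where "u = (\<lambda>y. v z y + (-1) * d y)"
  have dV: "d \<in> V" unfolding d_def using vX by (rule sum_in)
  have uV: "u \<in> V" unfolding u_def using vz dV by (intro add_in scale_in)
  have bV: "(\<lambda>y. \<Sum>x\<in>X. \<beta> x * v x y) \<in> V" using vX by (rule sum_in)
  have rV: "r \<in> V" unfolding r_def using insert.prems bV by (intro add_in scale_in)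
  have ip_d: "ip d g = (\<Sum>x\<in>X. \<delta> x * ip (v x) g)" if "g \<in> V" for g
    unfolding d_def using vX that by (rule form_sum_left)
  have ip_u: "ip u g = ip (v z) g - (\<Sum>x\<in>X. \<delta> x * ip (v x) g)" if "g \<in> V" for g
    unfolding u_def using vz dV that form_add[of "v z" "\<lambda>y. (-1) * d y" g] form_scale[of d g "-1"]
    by (simp add: scale_in[of d "-1", simplified] ip_d)
  have ip_r: "ip r g = ip f g - (\<Sum>x\<in>X. \<beta> x * ip (v x) g)" if "g \<in> V" for g
    unfolding r_def
    using insert.prems(2) bV that form_scale[OF bV that, of "-1"]
      form_add[OF insert.prems(2) scale_in[OF bV, of "-1"] that] form_sum_left[OF vX that, where \<alpha> = \<beta>]
    by simp
  have u_orth: "ip u (v y) = 0" if "y \<in> X" for y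
    using that \<delta> vX ip_u by simp
  have r_orth: "ip r (v y) = 0" if "y \<in> X" for y
    using that \<beta> vX ip_r by simp
  have ip_to_d: "ip g d = 0" if "g \<in> V" "\<And>y. y \<in> X \<Longrightarrow> ip g (v y) = 0" for g
  proof -
    have "ip g d = (\<Sum>x\<in>X. \<delta> x * ip (v x) g)"
      using form_sym[OF that(1) dV] ip_d[OF that(1)] by simp
    also have "\<dots> = 0"
      using that vX form_sym by (intro sum.neutral) auto
    finally show ?thesis .
  qed
  have to_z: "ip g (v z) = ip g u" if "g \<in> V" "\<And>y. y \<in> X \<Longrightarrow> ip g (v y) = 0" for g
  proof -
    have "ip g u = ip (v z) g - ip d g"
      using form_sym[OF that(1) uV] ip_u[OF that(1)] ip_d[OF that(1)] by simp
    then show ?thesis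
      using form_sym[OF that(1) vz] form_sym[OF that(1) dV] ip_to_d[OF that] by simp
  qed
  obtain t where t: "ip r (v z) = t * ip u (v z)"
  proof (cases "ip u (v z) = 0")
    case True
    then have "ip u u = 0" using to_z[OF uV u_orth] by simp
    then have "ip u r = 0" using null_vector_orthogonal uV rV by blast
    then have "ip r (v z) = 0" using to_z[OF rV r_orth] form_sym[OF uV rV] by simp
    then show ?thesis using that[of 0] by simp
  next
    case False
    then show ?thesis using that[of "ip r (v z) / ip u (v z)"] by simp
  qed
  define \<alpha> where "\<alpha> x = (if x = z then t else \<beta> x - t * \<delta> x)" for x
  have "ip f (v y) = (\<Sum>x\<in>insert z X. \<alpha> x * ip (v x) (v y))" if y: "y \<in> insert z X" for y
  proof -
    have "ip r (v y) = t * ip u (v y)"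
      using y t u_orth r_orth by auto
    then have "ip f (v y) = (\<Sum>x\<in>X. \<beta> x * ip (v x) (v y))
        + t * (ip (v z) (v y) - (\<Sum>x\<in>X. \<delta> x * ip (v x) (v y)))"
      using ip_r[of "v y"] ip_u[of "v y"] y vz vX by auto
    also have "\<dots> = t * ip (v z) (v y) + (\<Sum>x\<in>X. (\<beta> x - t * \<delta> x) * ip (v x) (v y))"
      by (simp add: algebra_simps sum_distrib_left sum_subtractf)
    also have "(\<Sum>x\<in>X. (\<beta> x - t * \<delta> x) * ip (v x) (v y)) = (\<Sum>x\<in>X. \<alpha> x * ip (v x) (v y))"
      using insert.hyps by (intro sum.cong) (auto simp: \<alpha>_def)
    finally show ?thesis
      using insert.hyps by (simp add: \<alpha>_def)
  qed
  then show ?case by blast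
qed simp

end

sublocale hilbert_function_space \<subseteq> semi_inner_product_space V ip
  by unfold_locales
    (simp_all add: zero_mem add_mem scale_mem ip_add ip_scale ip_nonneg, metis ip_sym)

lemma semi_inner_product_space_weighted:
  fixes w :: "'i \<Rightarrow> real"
  assumes "\<And>i. i \<in> I \<Longrightarrow> 0 \<le> w i"
  shows "semi_inner_product_space UNIV (\<lambda>u v. \<Sum>i\<in>I. w i * u i * v i)"
proof
  fix u :: "'i \<Rightarrow> real"
  show "0 \<le> (\<Sum>i\<in>I. w i * u i * u i)"
    using assms by (intro sum_nonneg) (simp add: mult.assoc)
qed (simp_all add: algebra_simps sum.distrib sum_distrib_left)

text \<open>A set of vectors with finitely many coordinates is spanned by finitely many of its members.
  The induction adds one coordinate at a time; the new coordinate costs at most one further member,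
  namely one that is not yet a combination of the chosen ones.\<close>

lemma finite_spanning_subset:
  fixes v :: "'a \<Rightarrow> 'i \<Rightarrow> real"
  assumes "finite I"
  shows "\<exists>X A. finite X \<and> X \<subseteq> \<Omega> \<and> (\<forall>y\<in>\<Omega>. \<forall>i\<in>I. v y i = (\<Sum>x\<in>X. A y x * v x i))"
  using assms
proof (induction I rule: finite_induct)
  case empty
  show ?case by (intro exI[of _ "{}"]) simp
next
  case (insert j I)
  then obtain X A where X: "finite X" "X \<subseteq> \<Omega>"
    and A: "\<And>y i. y \<in> \<Omega> \<Longrightarrow> i \<in> I \<Longrightarrow> v y i = (\<Sum>x\<in>X. A y x * v x i)"
    by blast
  define r where "r y i = v y i - (\<Sum>x\<in>X. A y x * v x i)" for y i
  have rI: "r y i = 0" if "y \<in> \<Omega>" "i \<in> I" for y i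
    using A that by (simp add: r_def)
  show ?case
  proof (cases "\<forall>y\<in>\<Omega>. r y j = 0")
    case True
    then show ?thesis using X A by (intro exI[of _ X] exI[of _ A]) (auto simp: r_def)
  next
    case False
    then obtain z where z: "z \<in> \<Omega>" "r z j \<noteq> 0" by blast
    define s where "s y = r y j / r z j" for y
    define B where "B y x = (if x \<in> X then A y x - s y * A z x else 0) + (if x = z then s y else 0)" for y x
    have "v y i = (\<Sum>x\<in>insert z X. B y x * v x i)" if y: "y \<in> \<Omega>" and i: "i \<in> insert j I" for y i
    proof -
      have "r y i = s y * r z i"
        using i y z rI by (auto simp: s_def)
      then have "v y i = (\<Sum>x\<in>X. (A y x - s y * A z x) * v x i) + s y * v z i"
        by (simp add: r_def algebra_simps sum_distrib_left sum_subtractf)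
      also have "(\<Sum>x\<in>X. (A y x - s y * A z x) * v x i)
          = (\<Sum>x\<in>insert z X. (if x \<in> X then A y x - s y * A z x else 0) * v x i)"
        using X by (intro sum.mono_neutral_cong_left) auto
      also have "s y * v z i = (\<Sum>x\<in>insert z X. (if x = z then s y else 0) * v x i)"
        using X by (simp add: if_distrib[of "\<lambda>t. t * _"] cong: if_cong)
      finally show ?thesis
        by (simp add: B_def distrib_right sum.distrib)
    qed
    then show ?thesis
      using X z by (intro exI[of _ "insert z X"] exI[of _ B]) auto
  qed
qed

section \<open>Native spaces of kernels with finitely many features\<close>

definition feature_combination ::
    "'a set \<Rightarrow> ('i \<Rightarrow> 'a \<Rightarrow> real) \<Rightarrow> 'i set \<Rightarrow> ('i \<Rightarrow> real) \<Rightarrow> 'a \<Rightarrow> real" where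
  "feature_combination \<Omega> \<phi> I c = (\<lambda>y. if y \<in> \<Omega> then \<Sum>i\<in>I. c i * \<phi> i y else 0)"

locale finite_feature_space = native_space \<Omega> k V ip
  for \<Omega> :: "'a set" and k V ip +
  fixes \<phi> :: "'i \<Rightarrow> 'a \<Rightarrow> real" and I :: "'i set" and w :: "'i \<Rightarrow> real"
  assumes finite_I: "finite I"
    and w_pos: "\<And>i. i \<in> I \<Longrightarrow> 0 < w i"
    and kernel_expansion: "\<And>x y. x \<in> \<Omega> \<Longrightarrow> y \<in> \<Omega> \<Longrightarrow> k x y = (\<Sum>i\<in>I. w i * \<phi> i x * \<phi> i y)"
begin

abbreviation section_at :: "'a \<Rightarrow> 'a \<Rightarrow> real" where
  "section_at \<equiv> kernel_section \<Omega> k"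

lemma section_at_eq:
  assumes "x \<in> \<Omega>" "y \<in> \<Omega>"
  shows "section_at x y = (\<Sum>i\<in>I. w i * \<phi> i x * \<phi> i y)"
  using assms by (simp add: kernel_section_def kernel_expansion mult_ac)

lemma section_combination_eq:
  assumes "X \<subseteq> \<Omega>" "y \<in> \<Omega>"
  shows "(\<Sum>x\<in>X. \<alpha> x * section_at x y) = (\<Sum>i\<in>I. (w i * (\<Sum>x\<in>X. \<alpha> x * \<phi> i x)) * \<phi> i y)"
proof -
  have "(\<Sum>x\<in>X. \<alpha> x * section_at x y) = (\<Sum>x\<in>X. \<Sum>i\<in>I. \<alpha> x * (w i * \<phi> i x * \<phi> i y))"
    using assms by (intro sum.cong) (auto simp: section_at_eq sum_distrib_left subset_iff)
  also have "\<dots> = (\<Sum>i\<in>I. \<Sum>x\<in>X. \<alpha> x * (w i * \<phi> i x * \<phi> i y))"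
    by (rule sum.swap)
  finally show ?thesis
    by (simp add: sum_distrib_left sum_distrib_right mult_ac)
qed

text \<open>The next two lemmas show that feature combinations and elements of the native space alike are
  finite combinations of kernel sections. Both solve the same interpolation problem on a finite set
  \<open>X\<close> whose feature vectors span those of all points: its matrix \<open>k x y\<close> is a Gram matrix of feature
  vectors, which suits the first case, and of kernel sections, which suits the second. Values on \<open>X\<close>
  then determine the values on \<open>\<Omega>\<close>.\<close>

lemma feature_combination_in_section_span:
  "\<exists>X \<alpha>. finite X \<and> X \<subseteq> \<Omega> \<and>
     feature_combination \<Omega> \<phi> I c = (\<lambda>y. \<Sum>x\<in>X. \<alpha> x * section_at x y)"
proof -
  interpret coeff: semi_inner_product_space UNIV "\<lambda>u v. \<Sum>i\<in>I. w i * u i * v i"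
    using w_pos by (intro semi_inner_product_space_weighted) (simp add: less_imp_le)
  obtain X A where X: "finite X" "X \<subseteq> \<Omega>"
    and A: "\<And>y i. y \<in> \<Omega> \<Longrightarrow> i \<in> I \<Longrightarrow> \<phi> i y = (\<Sum>x\<in>X. A y x * \<phi> i x)"
    using finite_spanning_subset[OF finite_I, of \<Omega> "\<lambda>y i. \<phi> i y"] by blast
  obtain \<alpha> where \<alpha>: "\<And>y. y \<in> X \<Longrightarrow> (\<Sum>i\<in>I. w i * (c i / w i) * \<phi> i y)
      = (\<Sum>x\<in>X. \<alpha> x * (\<Sum>i\<in>I. w i * \<phi> i x * \<phi> i y))"
    using coeff.normal_equations_solvable[OF X(1), of "\<lambda>y i. \<phi> i y" "\<lambda>i. c i / w i"] by auto
  define e where "e i = c i - w i * (\<Sum>x\<in>X. \<alpha> x * \<phi> i x)" for i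
  have on_X: "(\<Sum>i\<in>I. e i * \<phi> i y) = 0" if y: "y \<in> X" for y
  proof -
    have "(\<Sum>i\<in>I. c i * \<phi> i y) = (\<Sum>i\<in>I. w i * (c i / w i) * \<phi> i y)"
      using w_pos by (intro sum.cong) (auto simp: less_imp_neq[symmetric])
    also have "\<dots> = (\<Sum>x\<in>X. \<alpha> x * section_at x y)"
      using \<alpha>[OF y] X y by (auto simp: section_at_eq subset_iff intro!: sum.cong)
    also have "\<dots> = (\<Sum>i\<in>I. (w i * (\<Sum>x\<in>X. \<alpha> x * \<phi> i x)) * \<phi> i y)"
      using X y by (intro section_combination_eq) auto
    finally show ?thesis
      by (simp add: e_def left_diff_distrib sum_subtractf)
  qed
  have on_\<Omega>: "(\<Sum>i\<in>I. e i * \<phi> i y) = 0" if y: "y \<in> \<Omega>" for y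
  proof -
    have "(\<Sum>i\<in>I. e i * \<phi> i y) = (\<Sum>i\<in>I. \<Sum>x\<in>X. A y x * (e i * \<phi> i x))"
      using A[OF y] by (intro sum.cong) (simp_all add: sum_distrib_left mult_ac)
    also have "\<dots> = (\<Sum>x\<in>X. A y x * (\<Sum>i\<in>I. e i * \<phi> i x))"
      by (subst sum.swap) (simp add: sum_distrib_left)
    finally show ?thesis using on_X by simp
  qed
  have "feature_combination \<Omega> \<phi> I c y = (\<Sum>x\<in>X. \<alpha> x * section_at x y)" for y
  proof (cases "y \<in> \<Omega>")
    case True
    then show ?thesis
      using on_\<Omega>[OF True] section_combination_eq[OF X(2) True, of \<alpha>]
      by (simp add: feature_combination_def e_def left_diff_distrib sum_subtractf)
  next
    case False
    then show ?thesis by (simp add: feature_combination_def kernel_section_def)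
  qed
  then show ?thesis using X by blast
qed

lemma native_in_section_span:
  assumes f: "f \<in> V"
  shows "\<exists>X \<alpha>. finite X \<and> X \<subseteq> \<Omega> \<and> f = (\<lambda>y. \<Sum>x\<in>X. \<alpha> x * section_at x y)"
proof -
  obtain X A where X: "finite X" "X \<subseteq> \<Omega>"
    and A: "\<And>y i. y \<in> \<Omega> \<Longrightarrow> i \<in> I \<Longrightarrow> \<phi> i y = (\<Sum>x\<in>X. A y x * \<phi> i x)"
    using finite_spanning_subset[OF finite_I, of \<Omega> "\<lambda>y i. \<phi> i y"] by blast
  have sec: "section_at x \<in> V" if "x \<in> X" for x
    using that X section_mem by blast
  obtain \<alpha> where \<alpha>: "\<And>y. y \<in> X \<Longrightarrow> ip f (section_at y) = (\<Sum>x\<in>X. \<alpha> x * ip (section_at x) (section_at y))"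
    using normal_equations_solvable[OF X(1), of section_at f] sec f by blast
  define h where "h = (\<lambda>y. \<Sum>x\<in>X. \<alpha> x * section_at x y)"
  have hV: "h \<in> V" unfolding h_def using sec by (rule sum_in)
  have ev: "ip g (section_at y) = g y" if "g \<in> V" "y \<in> \<Omega>" for g y
    using that reproducing[of y g] section_mem[of y] ip_sym by metis
  have on_X: "f y = h y" if y: "y \<in> X" for y
  proof -
    have "y \<in> \<Omega>" using X y by blast
    then show ?thesis
      using \<alpha>[OF y] f sec by (simp add: ev h_def)
  qed
  have section_eq: "section_at y = (\<lambda>t. \<Sum>x\<in>X. A y x * section_at x t)" if y: "y \<in> \<Omega>" for y
  proof
    fix t
    show "section_at y t = (\<Sum>x\<in>X. A y x * section_at x t)"
    proof (cases "t \<in> \<Omega>")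
      case True
      have "section_at y t = (\<Sum>i\<in>I. w i * (\<Sum>x\<in>X. A y x * \<phi> i x) * \<phi> i t)"
        using A[OF y] section_at_eq[OF y True] by simp
      then show ?thesis
        using section_combination_eq[OF X(2) True] by simp
    qed (simp add: kernel_section_def)
  qed
  have extend: "g y = (\<Sum>x\<in>X. A y x * g x)" if g: "g \<in> V" and y: "y \<in> \<Omega>" for g y
  proof -
    have "g y = ip (\<lambda>t. \<Sum>x\<in>X. A y x * section_at x t) g"
      using reproducing[OF y g] section_eq[OF y] by simp
    also have "\<dots> = (\<Sum>x\<in>X. A y x * ip (section_at x) g)"
      using sec g by (rule form_sum_left)
    also have "\<dots> = (\<Sum>x\<in>X. A y x * g x)"
      using X g reproducing by (intro sum.cong) auto
    finally show ?thesis .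
  qed
  have "f y = h y" for y
  proof (cases "y \<in> \<Omega>")
    case True
    then show ?thesis using extend[OF f True] extend[OF hV True] on_X by simp
  next
    case False
    then show ?thesis using supported[OF f False] supported[OF hV False] by simp
  qed
  then have "f = (\<lambda>y. \<Sum>x\<in>X. \<alpha> x * section_at x y)" unfolding h_def by (rule ext)
  then show ?thesis using X by blast
qed

lemma feature_combination_mem: "feature_combination \<Omega> \<phi> I c \<in> V"
proof -
  obtain X \<alpha> where "X \<subseteq> \<Omega>"
    and eq: "feature_combination \<Omega> \<phi> I c = (\<lambda>y. \<Sum>x\<in>X. \<alpha> x * section_at x y)"
    using feature_combination_in_section_span[of c] by blast
  then show ?thesis
    unfolding eq using section_mem by (intro sum_in) blast
qed

lemma ip_with_section_combination:
  assumes "X \<subseteq> \<Omega>" and g: "g \<in> V"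
  shows "ip (\<lambda>y. \<Sum>x\<in>X. \<alpha> x * section_at x y) g = (\<Sum>x\<in>X. \<alpha> x * g x)"
proof -
  have "ip (\<lambda>y. \<Sum>x\<in>X. \<alpha> x * section_at x y) g = (\<Sum>x\<in>X. \<alpha> x * ip (section_at x) g)"
    using assms section_mem by (intro form_sum_left) auto
  also have "\<dots> = (\<Sum>x\<in>X. \<alpha> x * g x)"
    using assms reproducing by (intro sum.cong) auto
  finally show ?thesis .
qed

lemma norm_attained:
  assumes f: "f \<in> V"
  obtains c where "f = feature_combination \<Omega> \<phi> I c" and "ip f f = (\<Sum>i\<in>I. (c i)\<^sup>2 / w i)"
proof -
  obtain X \<alpha> where X: "X \<subseteq> \<Omega>" and eq: "f = (\<lambda>y. \<Sum>x\<in>X. \<alpha> x * section_at x y)"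
    using native_in_section_span[OF f] by blast
  define s where "s i = (\<Sum>x\<in>X. \<alpha> x * \<phi> i x)" for i
  define c where "c i = w i * s i" for i
  have f_on: "f y = (\<Sum>i\<in>I. c i * \<phi> i y)" if "y \<in> \<Omega>" for y
    using section_combination_eq[OF X that, of \<alpha>] by (simp add: eq c_def s_def)
  have "f = feature_combination \<Omega> \<phi> I c"
    using f_on supported[OF f] by (auto simp: feature_combination_def)
  moreover have "ip f f = (\<Sum>i\<in>I. (c i)\<^sup>2 / w i)"
  proof -
    have "ip f f = (\<Sum>x\<in>X. \<alpha> x * f x)"
      using ip_with_section_combination[OF X f, of \<alpha>] by (simp flip: eq)
    also have "\<dots> = (\<Sum>x\<in>X. \<Sum>i\<in>I. c i * (\<alpha> x * \<phi> i x))"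
      using X f_on by (intro sum.cong) (auto simp: sum_distrib_left mult_ac subset_iff)
    also have "\<dots> = (\<Sum>i\<in>I. c i * s i)"
      by (subst sum.swap) (simp add: s_def sum_distrib_left)
    also have "\<dots> = (\<Sum>i\<in>I. (c i)\<^sup>2 / w i)"
      using w_pos by (intro sum.cong) (auto simp: c_def power2_eq_square less_imp_neq[symmetric])
    finally show ?thesis .
  qed
  ultimately show ?thesis by (rule that)
qed

text \<open>Writing \<open>f = \<Sum>x. \<alpha> x * k(\<cdot>, x)\<close> and \<open>s i = \<Sum>x. \<alpha> x * \<phi> i x\<close>, the vector \<open>w i * s i\<close> represents \<open>f\<close>
  and has weighted square sum \<open>\<parallel>f\<parallel>\<^sup>2\<close>. The reproducing property says that every representing vector \<open>c\<close>
  has the same weighted inner product \<open>\<Sum>i. c i * s i = \<parallel>f\<parallel>\<^sup>2\<close> with it. Hence the difference of the two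
  is orthogonal to \<open>w i * s i\<close> and the claim is Pythagoras.\<close>

lemma norm_le_coefficients:
  assumes fc: "f = feature_combination \<Omega> \<phi> I c"
  shows "ip f f \<le> (\<Sum>i\<in>I. (c i)\<^sup>2 / w i)"
proof -
  have f: "f \<in> V" using feature_combination_mem fc by simp
  obtain X \<alpha> where X: "X \<subseteq> \<Omega>" and eq: "f = (\<lambda>y. \<Sum>x\<in>X. \<alpha> x * section_at x y)"
    using native_in_section_span[OF f] by blast
  define s where "s i = (\<Sum>x\<in>X. \<alpha> x * \<phi> i x)" for i
  have ip_eq: "ip f f = (\<Sum>i\<in>I. d i * s i)" if d: "\<And>y. y \<in> \<Omega> \<Longrightarrow> f y = (\<Sum>i\<in>I. d i * \<phi> i y)" for d
  proof -
    have "ip f f = (\<Sum>x\<in>X. \<alpha> x * f x)"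
      using ip_with_section_combination[OF X f, of \<alpha>] by (simp flip: eq)
    also have "\<dots> = (\<Sum>x\<in>X. \<Sum>i\<in>I. d i * (\<alpha> x * \<phi> i x))"
      using X d by (intro sum.cong) (auto simp: sum_distrib_left mult_ac subset_iff)
    also have "\<dots> = (\<Sum>i\<in>I. d i * s i)"
      by (subst sum.swap) (simp add: s_def sum_distrib_left)
    finally show ?thesis .
  qed
  have c_ip: "ip f f = (\<Sum>i\<in>I. c i * s i)"
    by (rule ip_eq) (simp add: fc feature_combination_def)
  have s_ip: "ip f f = (\<Sum>i\<in>I. (w i * s i) * s i)"
    using section_combination_eq[OF X, of _ \<alpha>] by (intro ip_eq) (simp add: eq s_def)
  have "0 \<le> (\<Sum>i\<in>I. (c i - w i * s i)\<^sup>2 / w i)"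
    using w_pos by (intro sum_nonneg) (simp add: less_imp_le)
  also have "\<dots> = (\<Sum>i\<in>I. (c i)\<^sup>2 / w i - 2 * (c i * s i) + (w i * s i) * s i)"
    using w_pos by (intro sum.cong) (auto simp: field_simps power2_eq_square less_imp_neq[symmetric])
  also have "\<dots> = (\<Sum>i\<in>I. (c i)\<^sup>2 / w i) - 2 * ip f f + ip f f"
    by (subst s_ip, subst c_ip) (simp add: sum.distrib sum_subtractf sum_distrib_left)
  finally show ?thesis by simp
qed

end

section \<open>Comparison of weights\<close>

lemma feature_combination_extend:
  assumes "finite J" "I \<subseteq> J"
  shows "feature_combination \<Omega> \<phi> I c = feature_combination \<Omega> \<phi> J (\<lambda>i. if i \<in> I then c i else 0)"
proof -
  have "(\<Sum>i\<in>I. c i * \<phi> i y) = (\<Sum>i\<in>J. (if i \<in> I then c i else 0) * \<phi> i y)" for y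
    using assms by (intro sum.mono_neutral_cong_left) auto
  then show ?thesis unfolding feature_combination_def by (intro ext if_cong) auto
qed

lemma weighted_square_le:
  fixes c u v C :: real
  assumes "0 < u" "0 < v" "u \<le> C * v"
  shows "c\<^sup>2 / v \<le> C * (c\<^sup>2 / u)"
proof -
  have "c\<^sup>2 * u \<le> c\<^sup>2 * (C * v)"
    using assms by (intro mult_left_mono) auto
  then show ?thesis
    using assms by (simp add: field_simps)
qed

lemma native_space_mono:
  assumes space1: "finite_feature_space \<Omega> k\<^sub>1 V\<^sub>1 ip\<^sub>1 \<phi> I w\<^sub>1"
    and space2: "finite_feature_space \<Omega> k\<^sub>2 V\<^sub>2 ip\<^sub>2 \<phi> J w\<^sub>2"
    and sub: "I \<subseteq> J" and weights: "\<And>i. i \<in> I \<Longrightarrow> w\<^sub>1 i \<le> C * w\<^sub>2 i"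
    and f: "f \<in> V\<^sub>1"
  shows "f \<in> V\<^sub>2 \<and> ip\<^sub>2 f f \<le> C * ip\<^sub>1 f f"
proof -
  interpret one: finite_feature_space \<Omega> k\<^sub>1 V\<^sub>1 ip\<^sub>1 \<phi> I w\<^sub>1 by (fact space1)
  interpret two: finite_feature_space \<Omega> k\<^sub>2 V\<^sub>2 ip\<^sub>2 \<phi> J w\<^sub>2 by (fact space2)
  obtain c where c: "f = feature_combination \<Omega> \<phi> I c" and n1: "ip\<^sub>1 f f = (\<Sum>i\<in>I. (c i)\<^sup>2 / w\<^sub>1 i)"
    using one.norm_attained[OF f] by blast
  define d where "d i = (if i \<in> I then c i else 0)" for i
  have fd: "f = feature_combination \<Omega> \<phi> J d"
    unfolding c d_def using two.finite_I sub by (rule feature_combination_extend)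
  have "ip\<^sub>2 f f \<le> (\<Sum>i\<in>J. (d i)\<^sup>2 / w\<^sub>2 i)"
    using fd by (rule two.norm_le_coefficients)
  also have "\<dots> = (\<Sum>i\<in>I. (c i)\<^sup>2 / w\<^sub>2 i)"
    using two.finite_I sub by (intro sum.mono_neutral_cong_right) (auto simp: d_def)
  also have "\<dots> \<le> (\<Sum>i\<in>I. C * ((c i)\<^sup>2 / w\<^sub>1 i))"
    using one.w_pos two.w_pos sub weights by (intro sum_mono weighted_square_le) auto
  also have "\<dots> = C * ip\<^sub>1 f f"
    by (simp add: n1 sum_distrib_left)
  finally show ?thesis
    using two.feature_combination_mem fd by simp
qed

text \<open>Independence makes the minimal representation of \<open>f\<close> in the larger space agree with its
  representation in the smaller one, so that its coefficients outside \<open>I\<close> vanish.\<close>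

lemma native_norm_le_of_independent:
  assumes space1: "finite_feature_space \<Omega> k\<^sub>1 V\<^sub>1 ip\<^sub>1 \<phi> I w\<^sub>1"
    and space2: "finite_feature_space \<Omega> k\<^sub>2 V\<^sub>2 ip\<^sub>2 \<phi> J w\<^sub>2"
    and sub: "I \<subseteq> J" and weights: "\<And>i. i \<in> I \<Longrightarrow> w\<^sub>2 i \<le> C * w\<^sub>1 i" and "0 \<le> C"
    and independent: "\<And>e. (\<And>y. y \<in> \<Omega> \<Longrightarrow> (\<Sum>i\<in>J. e i * \<phi> i y) = 0) \<Longrightarrow> (\<And>i. i \<in> J \<Longrightarrow> e i = 0)"
    and f: "f \<in> V\<^sub>1"
  shows "ip\<^sub>1 f f \<le> C * ip\<^sub>2 f f"
proof -
  interpret one: finite_feature_space \<Omega> k\<^sub>1 V\<^sub>1 ip\<^sub>1 \<phi> I w\<^sub>1 by (fact space1)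
  interpret two: finite_feature_space \<Omega> k\<^sub>2 V\<^sub>2 ip\<^sub>2 \<phi> J w\<^sub>2 by (fact space2)
  obtain c where c: "f = feature_combination \<Omega> \<phi> I c"
    using one.norm_attained[OF f] by blast
  define d where "d i = (if i \<in> I then c i else 0)" for i
  have fd: "f = feature_combination \<Omega> \<phi> J d"
    unfolding c d_def using two.finite_I sub by (rule feature_combination_extend)
  then have "f \<in> V\<^sub>2" using two.feature_combination_mem by simp
  then obtain b where b: "f = feature_combination \<Omega> \<phi> J b" and n2: "ip\<^sub>2 f f = (\<Sum>i\<in>J. (b i)\<^sup>2 / w\<^sub>2 i)"
    using two.norm_attained by blast
  have "(\<Sum>i\<in>J. (b i - d i) * \<phi> i y) = 0" if "y \<in> \<Omega>" for y
    using fun_cong[OF b, of y] fun_cong[OF fd, of y] that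
    by (simp add: feature_combination_def left_diff_distrib sum_subtractf)
  then have "b i - d i = 0" if "i \<in> J" for i
    using independent[of "\<lambda>i. b i - d i"] that by blast
  then have bd: "b i = c i" if "i \<in> I" for i
    using that sub by (fastforce simp: d_def)
  have "ip\<^sub>1 f f \<le> (\<Sum>i\<in>I. (c i)\<^sup>2 / w\<^sub>1 i)"
    using c by (rule one.norm_le_coefficients)
  also have "\<dots> = (\<Sum>i\<in>I. (b i)\<^sup>2 / w\<^sub>1 i)"
    using bd by simp
  also have "\<dots> \<le> (\<Sum>i\<in>I. C * ((b i)\<^sup>2 / w\<^sub>2 i))"
    using one.w_pos two.w_pos sub weights by (intro sum_mono weighted_square_le) auto
  also have "\<dots> \<le> (\<Sum>i\<in>J. C * ((b i)\<^sup>2 / w\<^sub>2 i))"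
    using two.finite_I sub two.w_pos \<open>0 \<le> C\<close> by (intro sum_mono2) (auto simp: less_imp_le)
  also have "\<dots> = C * ip\<^sub>2 f f"
    by (simp add: n2 sum_distrib_left)
  finally show ?thesis .
qed

section \<open>The monomial expansion of the polynomial kernel\<close>

definition monomial :: "('n::finite \<Rightarrow> nat) \<Rightarrow> real ^ 'n \<Rightarrow> real" where
  "monomial \<gamma> x = (\<Prod>i\<in>UNIV. (x $ i) ^ \<gamma> i)"

abbreviation degree_of :: "('n::finite \<Rightarrow> nat) \<Rightarrow> nat" where
  "degree_of \<gamma> \<equiv> (\<Sum>i\<in>UNIV. \<gamma> i)"

text \<open>This is the multinomial coefficient \<open>|\<gamma>|! / \<gamma>!\<close>. The description by words makes the multinomial
  theorem a matter of grouping words by their letter counts. The factor is the same for every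
  parameter and degree, so it cancels in ratios of weights once it is known to be positive.\<close>

definition multinomial :: "('n::finite \<Rightarrow> nat) \<Rightarrow> nat" where
  "multinomial \<gamma> = card {l. count_list l = \<gamma>}"

lemma length_eq_degree_of_count: "degree_of (count_list l) = length l"
  by (rule sum_count_set) auto

lemma finite_lists_of_length: "finite {l :: 'n::finite list. length l = j}"
  using finite_lists_length_eq[of "UNIV :: 'n set" j] by simp

lemma multinomial_pos: "0 < multinomial \<gamma>"
proof -
  obtain l where "mset l = (\<Sum>i\<in>UNIV. replicate_mset (\<gamma> i) i)"
    using ex_mset by blast
  then have "count (mset l) i = \<gamma> i" for i
    by (simp add: count_sum)
  then have "count_list l = \<gamma>"
    by (auto simp: count_mset)
  moreover have "finite {l. count_list l = \<gamma>}"
    by (intro finite_subset[OF _ finite_lists_of_length[of "degree_of \<gamma>"]])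
      (auto simp: length_eq_degree_of_count)
  ultimately show ?thesis
    by (auto simp: multinomial_def card_gt_0_iff)
qed

lemma finite_degree_eq: "finite {\<gamma> :: 'n::finite \<Rightarrow> nat. degree_of \<gamma> = j}"
proof -
  have "\<gamma> \<in> count_list ` {l. length l = j}" if "degree_of \<gamma> = j" for \<gamma> :: "'n \<Rightarrow> nat"
  proof -
    have "{l. count_list l = \<gamma>} \<noteq> {}"
      using multinomial_pos[of \<gamma>] by (metis multinomial_def card.empty less_irrefl)
    then obtain l where "\<gamma> = count_list l" by blast
    with that show ?thesis by (simp add: length_eq_degree_of_count)
  qed
  then show ?thesis
    by (intro finite_subset[OF _ finite_imageI[OF finite_lists_of_length[of j], of count_list]] subsetI)
      (simp only: mem_Collect_eq)
qed

lemma multi_indices_eq_UN: "multi_indices m = (\<Union>j\<in>{..m}. {\<gamma>. degree_of \<gamma> = j})"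
  by (auto simp: multi_indices_def)

lemma finite_multi_indices: "finite (multi_indices m :: ('n::finite \<Rightarrow> nat) set)"
  by (simp add: multi_indices_eq_UN finite_degree_eq)

lemma power_sum_words:
  fixes t :: "'n::finite \<Rightarrow> real"
  shows "(\<Sum>i\<in>UNIV. t i) ^ j = (\<Sum>l | length l = j. prod_list (map t l))"
proof (induction j)
  case (Suc j)
  have words: "{l :: 'n list. length l = Suc j} = (\<lambda>(i, l). i # l) ` (UNIV \<times> {l. length l = j})"
    by (auto simp: length_Suc_conv)
  have "(\<Sum>l | length l = Suc j. prod_list (map t l))
      = (\<Sum>(i, l)\<in>UNIV \<times> {l. length l = j}. t i * prod_list (map t l))"
    unfolding words by (subst sum.reindex) (auto simp: inj_on_def case_prod_beta)
  also have "\<dots> = (\<Sum>i\<in>UNIV. t i) * (\<Sum>l | length l = j. prod_list (map t l))"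
    by (simp add: sum_product sum.cartesian_product)
  finally show ?case using Suc by simp
qed simp

lemma prod_list_eq_prod_count:
  fixes t :: "'n::finite \<Rightarrow> real"
  shows "prod_list (map t l) = (\<Prod>i\<in>UNIV. t i ^ count_list l i)"
proof (induction l)
  case (Cons a l)
  have "(\<Prod>i\<in>UNIV. t i ^ count_list (a # l) i)
      = (\<Prod>i\<in>UNIV. (if i = a then t a else 1) * t i ^ count_list l i)"
    by (intro prod.cong) auto
  then show ?case using Cons by (simp add: prod.distrib)
qed simp

lemma inner_power_expansion:
  fixes x y :: "real ^ 'n"
  shows "(x \<bullet> y) ^ j = (\<Sum>\<gamma> | degree_of \<gamma> = j. real (multinomial \<gamma>) * monomial \<gamma> x * monomial \<gamma> y)"
proof -
  have "(x \<bullet> y) ^ j = (\<Sum>i\<in>UNIV. x $ i * y $ i) ^ j"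
    by (simp add: inner_vec_def)
  also have "\<dots> = (\<Sum>l | length l = j. monomial (count_list l) x * monomial (count_list l) y)"
    by (simp add: power_sum_words prod_list_eq_prod_count monomial_def power_mult_distrib prod.distrib)
  also have "\<dots> = (\<Sum>\<gamma> | degree_of \<gamma> = j. \<Sum>l | l \<in> {l. length l = j} \<and> count_list l = \<gamma>.
      monomial (count_list l) x * monomial (count_list l) y)"
    by (rule sum.group[symmetric])
      (auto simp: finite_lists_of_length finite_degree_eq length_eq_degree_of_count)
  also have "\<dots> = (\<Sum>\<gamma> | degree_of \<gamma> = j. real (multinomial \<gamma>) * monomial \<gamma> x * monomial \<gamma> y)"
  proof (rule sum.cong[OF refl])
    fix \<gamma> :: "'n \<Rightarrow> nat"
    assume "\<gamma> \<in> {\<gamma>. degree_of \<gamma> = j}"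
    then have words: "{l. l \<in> {l. length l = j} \<and> count_list l = \<gamma>} = {l. count_list l = \<gamma>}"
      by (auto simp: length_eq_degree_of_count)
    show "(\<Sum>l | l \<in> {l. length l = j} \<and> count_list l = \<gamma>.
        monomial (count_list l) x * monomial (count_list l) y)
      = real (multinomial \<gamma>) * monomial \<gamma> x * monomial \<gamma> y"
      unfolding words multinomial_def by simp
  qed
  finally show ?thesis .
qed

definition poly_weight :: "real \<Rightarrow> nat \<Rightarrow> ('n::finite \<Rightarrow> nat) \<Rightarrow> real" where
  "poly_weight b m \<gamma> =
     real (m choose degree_of \<gamma>) * b ^ (m - degree_of \<gamma>) * real (multinomial \<gamma>)"

lemma poly_weight_pos:
  assumes "0 < b" "\<gamma> \<in> multi_indices m"
  shows "0 < poly_weight b m \<gamma>"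
  using assms multinomial_pos[of \<gamma>] by (simp add: poly_weight_def multi_indices_def)

lemma poly_kernel_expansion:
  fixes x y :: "real ^ 'n"
  shows "poly_kernel b m x y
    = (\<Sum>\<gamma>\<in>multi_indices m. poly_weight b m \<gamma> * monomial \<gamma> x * monomial \<gamma> y)"
proof -
  have "poly_kernel b m x y = (\<Sum>j\<le>m. real (m choose j) * (x \<bullet> y) ^ j * b ^ (m - j))"
    unfolding poly_kernel_def by (subst add.commute) (rule binomial_ring)
  also have "\<dots> = (\<Sum>j\<le>m. \<Sum>\<gamma> | degree_of \<gamma> = j. poly_weight b m \<gamma> * monomial \<gamma> x * monomial \<gamma> y)"
    unfolding inner_power_expansion sum_distrib_left sum_distrib_right
    by (intro sum.cong) (auto simp: poly_weight_def)
  also have "\<dots> = (\<Sum>\<gamma>\<in>multi_indices m. poly_weight b m \<gamma> * monomial \<gamma> x * monomial \<gamma> y)"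
    unfolding multi_indices_eq_UN
    by (rule sum.UNION_disjoint[symmetric]) (auto simp: finite_degree_eq)
  finally show ?thesis .
qed

lemma poly_kernel_zero_expansion:
  fixes x y :: "real ^ 'n"
  shows "poly_kernel 0 m x y
    = (\<Sum>\<gamma> | degree_of \<gamma> = m. real (multinomial \<gamma>) * monomial \<gamma> x * monomial \<gamma> y)"
  by (simp add: poly_kernel_def inner_power_expansion)

lemma poly_feature_space:
  assumes "native_space \<Omega> (poly_kernel b m) V ip" "0 < b"
  shows "finite_feature_space \<Omega> (poly_kernel b m) V ip monomial (multi_indices m) (poly_weight b m)"
  using assms
  by (intro finite_feature_space.intro finite_feature_space_axioms.intro)
    (simp_all add: finite_multi_indices poly_weight_pos poly_kernel_expansion)

lemma poly_zero_feature_space: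
  assumes "native_space \<Omega> (poly_kernel 0 m) V ip"
  shows "finite_feature_space \<Omega> (poly_kernel 0 m) V ip monomial
    {\<gamma>. degree_of \<gamma> = m} (\<lambda>\<gamma>. real (multinomial \<gamma>))"
  using assms
  by (intro finite_feature_space.intro finite_feature_space_axioms.intro)
    (simp_all add: finite_degree_eq multinomial_pos poly_kernel_zero_expansion)

section \<open>Weights for different parameters\<close>

lemma poly_weight_mono:
  assumes "0 < a'" "a' \<le> a"
  shows "poly_weight a' m \<gamma> \<le> poly_weight a m \<gamma>"
  unfolding poly_weight_def using assms by (intro mult_mono power_mono) auto

text \<open>The ratio of the weights at \<open>|\<gamma>| = j\<close> is \<open>(a / a') ^ (m - j)\<close>, which is largest for \<open>j = 0\<close>.\<close>

lemma poly_weight_shrink: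
  assumes "0 < a'" "a' \<le> a"
  shows "poly_weight a m \<gamma> \<le> (a / a') ^ m * poly_weight a' m \<gamma>"
proof -
  let ?n = "m - degree_of \<gamma>"
  have "a ^ ?n = (a / a') ^ ?n * a' ^ ?n"
    using assms by (simp add: power_divide)
  also have "\<dots> \<le> (a / a') ^ m * a' ^ ?n"
    using assms by (intro mult_right_mono power_increasing) auto
  finally have "real (m choose degree_of \<gamma>) * a ^ ?n * real (multinomial \<gamma>)
      \<le> real (m choose degree_of \<gamma>) * ((a / a') ^ m * a' ^ ?n) * real (multinomial \<gamma>)"
    by (intro mult_right_mono mult_left_mono) auto
  then show ?thesis by (simp add: poly_weight_def mult_ac)
qed

lemma poly_weight_top_degree:
  assumes "degree_of \<gamma> = m"
  shows "poly_weight a m \<gamma> = real (multinomial \<gamma>)"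
  using assms by (simp add: poly_weight_def)

lemma multi_indices_mono: "q \<le> p \<Longrightarrow> multi_indices q \<subseteq> multi_indices p"
  by (auto simp: multi_indices_def)

lemma poly_weight_degree_le:
  assumes "0 < a" "q \<le> p" "\<gamma> \<in> multi_indices q"
  shows "a ^ (p - q) * poly_weight a q \<gamma> \<le> poly_weight a p \<gamma>"
proof -
  let ?j = "degree_of \<gamma>"
  have "?j \<le> q" using assms by (simp add: multi_indices_def)
  then have split: "a ^ (p - ?j) = a ^ (p - q) * a ^ (q - ?j)"
    using assms by (simp flip: power_add)
  have "real (q choose ?j) * (a ^ (p - ?j) * real (multinomial \<gamma>))
      \<le> real (p choose ?j) * (a ^ (p - ?j) * real (multinomial \<gamma>))"
    using assms by (intro mult_right_mono) (auto simp: binomial_right_mono)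
  then show ?thesis by (simp add: poly_weight_def split mult_ac)
qed

text \<open>Choosing \<open>q\<close> of \<open>p\<close> elements and then \<open>j\<close> of those \<open>q\<close> is at least as much as choosing \<open>j\<close> of
  \<open>p\<close>, because every set of size \<open>j\<close> extends to one of size \<open>q\<close>. Equality holds for \<open>j = q\<close>, so the
  constant is sharp.\<close>

lemma binomial_le_product:
  fixes p q j :: nat
  assumes "j \<le> q" "q \<le> p"
  shows "p choose j \<le> (p choose (p - q)) * (q choose j)"
proof -
  have "(p choose q) * (q choose j) = (p choose j) * ((p - j) choose (q - j))"
    using assms by (intro choose_mult)
  moreover have "1 \<le> (p - j) choose (q - j)"
    using assms by (simp add: Suc_le_eq)
  ultimately show ?thesis
    unfolding binomial_symmetric[OF assms(2), symmetric] by simp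
qed

lemma poly_weight_degree_ge:
  assumes "0 < a" "q \<le> p" "\<gamma> \<in> multi_indices q"
  shows "poly_weight a p \<gamma> \<le> (a ^ (p - q) * real (p choose (p - q))) * poly_weight a q \<gamma>"
proof -
  let ?j = "degree_of \<gamma>"
  have j: "?j \<le> q" using assms by (simp add: multi_indices_def)
  then have split: "a ^ (p - ?j) = a ^ (p - q) * a ^ (q - ?j)"
    using assms by (simp flip: power_add)
  have "real (p choose ?j) \<le> real (p choose (p - q)) * real (q choose ?j)"
    using binomial_le_product[OF j assms(2)] by (simp flip: of_nat_mult)
  then have "real (p choose ?j) * (a ^ (p - ?j) * real (multinomial \<gamma>))
      \<le> (real (p choose (p - q)) * real (q choose ?j)) * (a ^ (p - ?j) * real (multinomial \<gamma>))"
    using assms by (intro mult_right_mono) auto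
  then show ?thesis by (simp add: poly_weight_def split mult_ac)
qed

lemma determines_polys_independent:
  assumes "determines_polys p \<Omega>"
    and "\<And>y. y \<in> \<Omega> \<Longrightarrow> (\<Sum>\<gamma>\<in>multi_indices p. e \<gamma> * monomial \<gamma> y) = 0"
    and "\<gamma> \<in> multi_indices p"
  shows "e \<gamma> = 0"
  using assms unfolding determines_polys_def monomial_def by blast

lemma powr_half_eq_sqrt_power:
  fixes r :: real
  assumes "0 < r"
  shows "r powr (real n / 2) = sqrt (r ^ n)"
proof -
  have "r powr (real n / 2) = (r powr real n) powr (1 / 2)"
    by (simp add: powr_powr)
  also have "\<dots> = sqrt (r ^ n)"
    using assms by (simp add: powr_half_sqrt powr_realpow)
  finally show ?thesis .
qed

theorem corollary12:
  fixes \<Omega> :: "(real ^ 'n) set"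
    and H :: "real \<Rightarrow> nat \<Rightarrow> (real ^ 'n \<Rightarrow> real) set"
    and ip :: "real \<Rightarrow> nat \<Rightarrow> (real ^ 'n \<Rightarrow> real) \<Rightarrow> (real ^ 'n \<Rightarrow> real) \<Rightarrow> real"
    and a :: real and p :: nat
  assumes native: "\<And>b m. 0 \<le> b \<Longrightarrow> native_space \<Omega> (poly_kernel b m) (H b m) (ip b m)"
    and a_nonneg: "0 \<le> a"
  shows "(\<forall>a'. 0 < a' \<and> a' \<le> a \<longrightarrow>
            H a p = H a' p \<and>
            (\<forall>f\<in>H a p.
               (a' / a) powr (real p / 2) * ip_norm (ip a' p) f \<le> ip_norm (ip a p) f \<and>
               ip_norm (ip a p) f \<le> ip_norm (ip a' p) f)) \<and>
         (0 < a \<longrightarrow>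
            H 0 p \<subseteq> H a p \<and>
            (determines_polys p \<Omega> \<longrightarrow>
               (\<forall>f\<in>H 0 p. ip_norm (ip a p) f = ip_norm (ip 0 p) f))) \<and>
         (\<forall>q. 0 < a \<and> q \<le> p \<longrightarrow>
            H a q \<subseteq> H a p \<and>
            (\<forall>f\<in>H a q.
               a powr ((real p - real q) / 2) * ip_norm (ip a p) f \<le> ip_norm (ip a q) f \<and>
               (determines_polys p \<Omega> \<longrightarrow>
                  ip_norm (ip a q) f \<le>
                    a powr ((real p - real q) / 2) * real (p choose (p - q)) powr (1 / 2)
                      * ip_norm (ip a p) f)))"
proof -
  note norms = ip_norm_def real_sqrt_mult[symmetric]
  have space: "finite_feature_space \<Omega> (poly_kernel b m) (H b m) (ip b m) monomial
      (multi_indices m) (poly_weight b m)" if "0 < b" for b m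
    using native[of b m] that by (intro poly_feature_space) auto
  have space0: "finite_feature_space \<Omega> (poly_kernel 0 m) (H 0 m) (ip 0 m) monomial
      {\<gamma>. degree_of \<gamma> = m} (\<lambda>\<gamma>. real (multinomial \<gamma>))" for m
    using native[of 0 m] by (intro poly_zero_feature_space) auto
  have part1: "H a p = H a' p \<and>
      (\<forall>f\<in>H a p.
         (a' / a) powr (real p / 2) * ip_norm (ip a' p) f \<le> ip_norm (ip a p) f \<and>
         ip_norm (ip a p) f \<le> ip_norm (ip a' p) f)" if a': "0 < a'" "a' \<le> a" for a'
  proof -
    have a: "0 < a" using a' by simp
    have up: "f \<in> H a p \<and> ip a p f f \<le> 1 * ip a' p f f" if "f \<in> H a' p" for f
      by (rule native_space_mono[OF space[OF a'(1)] space[OF a] order_refl _ that])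
        (simp add: poly_weight_mono[OF a'])
    have down: "f \<in> H a' p \<and> ip a' p f f \<le> (a / a') ^ p * ip a p f f" if "f \<in> H a p" for f
      by (rule native_space_mono[OF space[OF a] space[OF a'(1)] order_refl _ that])
        (rule poly_weight_shrink[OF a'])
    have "(a' / a) powr (real p / 2) * ip_norm (ip a' p) f \<le> ip_norm (ip a p) f"
      if "f \<in> H a p" for f
    proof -
      have "(a' / a) ^ p * ip a' p f f \<le> (a' / a) ^ p * ((a / a') ^ p * ip a p f f)"
        using down[OF that] a a' by (intro mult_left_mono) auto
      also have "\<dots> = ip a p f f"
        using a a' by (simp add: power_divide)
      finally show ?thesis
        using a a' by (simp add: powr_half_eq_sqrt_power norms)
    qed
    then show ?thesis
      using up down by (auto simp: ip_norm_def)
  qed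
  have part2: "H 0 p \<subseteq> H a p \<and>
      (determines_polys p \<Omega> \<longrightarrow> (\<forall>f\<in>H 0 p. ip_norm (ip a p) f = ip_norm (ip 0 p) f))" if a: "0 < a"
  proof -
    have sub: "{\<gamma> :: 'n \<Rightarrow> nat. degree_of \<gamma> = p} \<subseteq> multi_indices p"
      by (auto simp: multi_indices_def)
    have up: "f \<in> H a p \<and> ip a p f f \<le> 1 * ip 0 p f f" if "f \<in> H 0 p" for f
      by (rule native_space_mono[OF space0 space[OF a] sub _ that])
        (simp add: poly_weight_top_degree)
    have "ip 0 p f f \<le> 1 * ip a p f f" if "determines_polys p \<Omega>" "f \<in> H 0 p" for f
      by (rule native_norm_le_of_independent[OF space0 space[OF a] sub _ _ _ that(2)])
        (auto simp: poly_weight_top_degree intro: determines_polys_independent[OF that(1)])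
    then show ?thesis
      using up by (fastforce simp: ip_norm_def intro: antisym)
  qed
  have part3: "H a q \<subseteq> H a p \<and>
      (\<forall>f\<in>H a q.
         a powr ((real p - real q) / 2) * ip_norm (ip a p) f \<le> ip_norm (ip a q) f \<and>
         (determines_polys p \<Omega> \<longrightarrow>
            ip_norm (ip a q) f \<le>
              a powr ((real p - real q) / 2) * real (p choose (p - q)) powr (1 / 2)
                * ip_norm (ip a p) f))" if a: "0 < a" and q: "q \<le> p" for q
  proof -
    let ?C = "a ^ (p - q)"
    have powr_eq: "a powr ((real p - real q) / 2) = sqrt ?C"
      using powr_half_eq_sqrt_power[OF a, of "p - q"] q by (simp add: of_nat_diff)
    have up: "f \<in> H a p \<and> ip a p f f \<le> inverse ?C * ip a q f f" if "f \<in> H a q" for f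
    proof (rule native_space_mono[OF space[OF a] space[OF a] multi_indices_mono[OF q] _ that])
      fix \<gamma> :: "'n \<Rightarrow> nat"
      assume "\<gamma> \<in> multi_indices q"
      then show "poly_weight a q \<gamma> \<le> inverse ?C * poly_weight a p \<gamma>"
        using poly_weight_degree_le[OF a q, of \<gamma>] a by (simp add: field_simps)
    qed
    have "a powr ((real p - real q) / 2) * ip_norm (ip a p) f \<le> ip_norm (ip a q) f"
      if "f \<in> H a q" for f
    proof -
      have "?C * ip a p f f \<le> ip a q f f"
        using up[OF that] a by (simp add: field_simps)
      then show ?thesis by (simp add: powr_eq norms)
    qed
    moreover have "ip_norm (ip a q) f \<le>
        a powr ((real p - real q) / 2) * real (p choose (p - q)) powr (1 / 2) * ip_norm (ip a p) f"
      if "determines_polys p \<Omega>" "f \<in> H a q" for f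
    proof -
      have "ip a q f f \<le> (?C * real (p choose (p - q))) * ip a p f f"
        by (rule native_norm_le_of_independent[OF space[OF a] space[OF a]
              multi_indices_mono[OF q] _ _ _ that(2)])
          (use a in \<open>auto simp: poly_weight_degree_ge[OF a q]
              intro: determines_polys_independent[OF that(1)]\<close>)
      then show ?thesis by (simp add: powr_eq powr_half_sqrt norms)
    qed
    ultimately show ?thesis using up by blast
  qed
  show ?thesis using part1 part2 part3 by blast
qed

end
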